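(* Let $X$ be a Hilbert space, $(P,d)$ a metric space, $g\colon X\times P\to(-\infty,\infty]$ lower semicontinuous, and let $\bar v\in\partial_xg(\bar x,\bar p)$. Suppose that $g$ is parametrically continuously prox-regular at $(\bar x,\bar p)$ for $\bar v$ and that the mapping $p\mapsto\mathrm{epi}\,g(\cdot,p)$ is Lipschitz-like around $(\bar p,(\bar x,g(\bar x,\bar p)))$. Then $\bar x$ is a Hölderian fully stable local minimizer associated with $g$ relative to the parameter pair $(\bar v,\bar p)$ if and only if $\bar x$ is a Hölderian fully stable solution to the parametric variational system $v\in\partial_xg(x,p)$ corresponding to $(\bar v,\bar p)$.
   Context: $X$ is a real Hilbert space identified with its dual; $\mathbb B$ is the closed unit ball and $\mathbb B_\gamma(\bar x)$ the closed ball of radius $\gamma$ at $\bar x$. Subdifferentials. For lower semicontinuous $\varphi\colon X\to(-\infty,\infty]$ and $\varphi(\bar x)<\infty$: $\widehat\partial\varphi(\bar x)=\{v:\liminf_{x\to\bar x}[\varphi(x)-\varphi(\bar x)-\langle v,x-\bar x\rangle]/\|x-\bar x\|\ge0\}$; the limiting subdifferential $\partial\varphi(\bar x)$ is the set of $v$ for which there are sequences $x_k\to\bar x$ with $\varphi(x_k)\to\varphi(\bar x)$ and $v_k\in\widehat\partial\varphi(x_k)$ converging weakly to $v$. $\partial_xg(x,p):=\partial g(\cdot,p)(x)$ and $\mathrm{gph}\,\partial_xg=\{(x,p,v):v\in\partial_xg(x,p)\}$. Parametric continuous prox-regularity of $g$ at $(\bar x,\bar p)$ for $\bar v$: there are neighborhoods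 $U$ of $\bar x$, $V$ of $\bar v$, $Q$ of $\bar p$ and $\varepsilon,r>0$ such that $g(x,p)\ge g(u,p)+\langle v,x-u\rangle-\frac r2\|x-u\|^2$ for all $x\in U$ whenever $v\in\partial_xg(u,p)\cap V$, $u\in U$, $p\in Q$, $g(u,p)\le g(\bar x,\bar p)+\varepsilon$; and the mapping $(x,p,v)\mapsto g(x,p)$ is continuous relative to $\mathrm{gph}\,\partial_xg$ at $(\bar x,\bar p,\bar v)$. Lipschitz-like property. $F\colon P\rightrightarrows Y$ ($Y$ normed) is Lipschitz-like around $(\bar p,\bar y)\in\mathrm{gph}\,F$ if there are neighborhoods $Q$ of $\bar p$, $W$ of $\bar y$ and $\ell>0$ with $F(p)\cap W\subset F(q)+\ell d(p,q)\mathbb B$ for all $p,q\in Q$. Hölderian fully stable local minimizer. $\bar x$ is such a minimizer associated with $g$ relative to $(\bar v,\bar p)$ if there are $\kappa,\ell,\gamma>0$ and a neighborhood $V\times Q$ of $(\bar v,\bar p)$ such that the mapping $M_\gamma(v,p)=\mathrm{argmin}\{g(x,p)-\langle v,x\rangle:x\in\mathbb B_\gamma(\bar x)\}$ is single-valued on $V\times Q$ with $M_\gamma(\bar v,\bar p)=\bar x$ and $\|M_\gamma(v_1,p_1)-M_\gamma(v_2,p_2)\|\le\kappa\|v_1-v_2\|+\ell d(p_1,p_2)^{1/2}$ for all $v_1,v_2\in V$, $p_1,p_2\in Q$. Hölderian fully stable solution of $v\in\partial_xg(x,p)$. With $S(v,p)=\{x:v\in\partial_xg(x,p)\}$, $\bar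 x\in S(\bar v,\bar p)$ is Hölderian fully stable corresponding to $(\bar v,\bar p)$ if there are a neighborhood $V\times Q\times U$ of $(\bar v,\bar p,\bar x)$, constants $\kappa,\ell>0$, and a single-valued mapping $\vartheta\colon V\times Q\to U$ defined on all of $V\times Q$ with $\mathrm{gph}\,\vartheta=\mathrm{gph}\,S\cap(V\times Q\times U)$ and $\|(v_1-v_2)-2\kappa[\vartheta(v_1,p_1)-\vartheta(v_2,p_2)]\|\le\|v_1-v_2\|+\ell\,d(p_1,p_2)^{1/2}$ for all $(v_1,p_1),(v_2,p_2)\in V\times Q$. *)

theory Defs
  imports "HOL-Analysis.Analysis"
begin

text \<open>
  Real Hilbert spaces are types of sort \<open>{real_inner, complete_space}\<close>, identified with their dual,
  so subgradients are elements of the space itself. Extended-real-valued functions take values in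
  \<^typ>\<open>ereal\<close>; that \<open>-\<infinity>\<close> is excluded is assumed separately. A neighborhood of \<open>x\<close> is any set with
  \<open>x\<close> in its interior, not necessarily an open one.
\<close>

definition lower_semicontinuous :: "('a::topological_space \<Rightarrow> ereal) \<Rightarrow> bool" where
  "lower_semicontinuous \<phi> \<longleftrightarrow> (\<forall>x. \<phi> x \<le> Liminf (at x) \<phi>)"

text \<open>
  The subdifferentials are empty outside the effective domain. The condition
  \<open>\<bar>\<phi> x\<bar> \<noteq> \<infinity>\<close> is \<open>\<phi> x < \<infinity>\<close> for functions that do not attain \<open>-\<infinity>\<close>.
\<close>

definition regular_subdiff :: "('a::real_inner \<Rightarrow> ereal) \<Rightarrow> 'a \<Rightarrow> 'a set" where
  "regular_subdiff \<phi> x = {v. \<bar>\<phi> x\<bar> \<noteq> \<infinity> \<and>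
     Liminf (at x) (\<lambda>y. (\<phi> y - \<phi> x - ereal (v \<bullet> (y - x))) / ereal (norm (y - x))) \<ge> 0}"

definition weakly_convergent_to :: "(nat \<Rightarrow> 'a::real_inner) \<Rightarrow> 'a \<Rightarrow> bool" where
  "weakly_convergent_to vs v \<longleftrightarrow> (\<forall>w. (\<lambda>k. vs k \<bullet> w) \<longlonglongrightarrow> v \<bullet> w)"

definition limiting_subdiff :: "('a::real_inner \<Rightarrow> ereal) \<Rightarrow> 'a \<Rightarrow> 'a set" where
  "limiting_subdiff \<phi> x = {v. \<bar>\<phi> x\<bar> \<noteq> \<infinity> \<and>
     (\<exists>xs vs. xs \<longlonglongrightarrow> x \<and> (\<lambda>k. \<phi> (xs k)) \<longlonglongrightarrow> \<phi> x \<and>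
        (\<forall>k. vs k \<in> regular_subdiff \<phi> (xs k)) \<and> weakly_convergent_to vs v)}"

definition partial_subdiff :: "('a::real_inner \<Rightarrow> 'p \<Rightarrow> ereal) \<Rightarrow> 'a \<Rightarrow> 'p \<Rightarrow> 'a set" where
  "partial_subdiff g x p = limiting_subdiff (\<lambda>y. g y p) x"

definition gph_partial_subdiff :: "('a::real_inner \<Rightarrow> 'p \<Rightarrow> ereal) \<Rightarrow> ('a \<times> 'p \<times> 'a) set" where
  "gph_partial_subdiff g = {(x, p, v). v \<in> partial_subdiff g x p}"

definition param_cont_prox_regular ::
    "('a::real_inner \<Rightarrow> 'p::metric_space \<Rightarrow> ereal) \<Rightarrow> 'a \<Rightarrow> 'p \<Rightarrow> 'a \<Rightarrow> bool" where
  "param_cont_prox_regular g xbar pbar vbar \<longleftrightarrow>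
     (\<exists>U V Q. \<exists>\<epsilon>>0. \<exists>r>0. xbar \<in> interior U \<and> vbar \<in> interior V \<and> pbar \<in> interior Q \<and>
        (\<forall>u\<in>U. \<forall>p\<in>Q. \<forall>v \<in> partial_subdiff g u p \<inter> V. g u p \<le> g xbar pbar + ereal \<epsilon> \<longrightarrow>
           (\<forall>x\<in>U. g x p \<ge> g u p + ereal (v \<bullet> (x - u)) - ereal (r / 2 * (norm (x - u))\<^sup>2)))) \<and>
     continuous (at (xbar, pbar, vbar) within gph_partial_subdiff g) (\<lambda>(x, p, v). g x p)"

text \<open>The library's \<^const>\<open>epigraph\<close> covers real-valued functions only.\<close>

definition epi :: "('a \<Rightarrow> ereal) \<Rightarrow> ('a \<times> real) set" where
  "epi \<phi> = {(x, \<alpha>). \<phi> x \<le> ereal \<alpha>}"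

definition lipschitz_like :: "('p::metric_space \<Rightarrow> 'y::real_normed_vector set) \<Rightarrow> 'p \<Rightarrow> 'y \<Rightarrow> bool" where
  "lipschitz_like F pbar ybar \<longleftrightarrow> ybar \<in> F pbar \<and>
     (\<exists>Q W. \<exists>l>0. pbar \<in> interior Q \<and> ybar \<in> interior W \<and>
        (\<forall>p\<in>Q. \<forall>q\<in>Q. F p \<inter> W \<subseteq> {y + (l * dist p q) *\<^sub>R b | y b. y \<in> F q \<and> b \<in> cball 0 1}))"

definition argmin_map ::
    "('a::real_inner \<Rightarrow> 'p \<Rightarrow> ereal) \<Rightarrow> 'a \<Rightarrow> real \<Rightarrow> 'a \<Rightarrow> 'p \<Rightarrow> 'a set" where
  "argmin_map g xbar \<gamma> v p =
     {x. is_arg_min (\<lambda>x. g x p - ereal (v \<bullet> x)) (\<lambda>x. x \<in> cball xbar \<gamma>) x}"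

definition hoelder_fully_stable_minimizer ::
    "('a::real_inner \<Rightarrow> 'p::metric_space \<Rightarrow> ereal) \<Rightarrow> 'a \<Rightarrow> 'a \<Rightarrow> 'p \<Rightarrow> bool" where
  "hoelder_fully_stable_minimizer g xbar vbar pbar \<longleftrightarrow>
     (\<exists>\<kappa>>0. \<exists>l>0. \<exists>\<gamma>>0. \<exists>V Q m. vbar \<in> interior V \<and> pbar \<in> interior Q \<and>
        (\<forall>v\<in>V. \<forall>p\<in>Q. argmin_map g xbar \<gamma> v p = {m v p}) \<and>
        m vbar pbar = xbar \<and>
        (\<forall>v1\<in>V. \<forall>v2\<in>V. \<forall>p1\<in>Q. \<forall>p2\<in>Q.
           norm (m v1 p1 - m v2 p2) \<le> \<kappa> * norm (v1 - v2) + l * sqrt (dist p1 p2)))"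

definition solution_map :: "('a::real_inner \<Rightarrow> 'p \<Rightarrow> ereal) \<Rightarrow> 'a \<Rightarrow> 'p \<Rightarrow> 'a set" where
  "solution_map g v p = {x. v \<in> partial_subdiff g x p}"

text \<open>Only the restriction of the total function \<open>\<theta>\<close> to \<open>V \<times> Q\<close> is meaningful.\<close>

definition hoelder_fully_stable_solution ::
    "('a::real_inner \<Rightarrow> 'p::metric_space \<Rightarrow> ereal) \<Rightarrow> 'a \<Rightarrow> 'a \<Rightarrow> 'p \<Rightarrow> bool" where
  "hoelder_fully_stable_solution g xbar vbar pbar \<longleftrightarrow>
     xbar \<in> solution_map g vbar pbar \<and>
     (\<exists>V Q U. \<exists>\<kappa>>0. \<exists>l>0. \<exists>\<theta>.
        vbar \<in> interior V \<and> pbar \<in> interior Q \<and> xbar \<in> interior U \<and>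
        (\<forall>v\<in>V. \<forall>p\<in>Q. \<theta> v p \<in> U) \<and>
        {(v, p, \<theta> v p) | v p. v \<in> V \<and> p \<in> Q}
          = {(v, p, x). x \<in> solution_map g v p} \<inter> (V \<times> Q \<times> U) \<and>
        (\<forall>v1\<in>V. \<forall>v2\<in>V. \<forall>p1\<in>Q. \<forall>p2\<in>Q.
           norm ((v1 - v2) - (2 * \<kappa>) *\<^sub>R (\<theta> v1 p1 - \<theta> v2 p2))
             \<le> norm (v1 - v2) + l * sqrt (dist p1 p2)))"

end

theory Submission
  imports Defs
begin

text \<open>
  Write \<open>\<theta>\<close> for the map given by either side: the minimizers \<open>M\<^sub>\<gamma>(v, p)\<close> or the localized solutions of
  \<open>v \<in> \<partial>\<^sub>x g(x, p)\<close>. On both sides \<open>\<theta>\<close> is Lipschitz in \<open>v\<close>, Hoelder in \<open>p\<close>, and monotone in \<open>v\<close>. What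
  remains is to pass between "\<open>\<theta>(v, p)\<close> minimizes the tilted function \<open>g(\<cdot>, p) - \<langle>v, \<cdot>\<rangle>\<close>" and
  "\<open>\<theta>(v, p)\<close> is the only nearby point with subgradient \<open>v\<close>", one parameter \<open>p\<close> at a time. Prox-regularity
  makes every nearby subgradient \<open>v\<close> at \<open>u\<close> a support of \<open>g(\<cdot>, p)\<close> from below up to the error
  \<open>r/2 \<parallel>x - u\<parallel>\<^sup>2\<close>, so the whole problem is to get rid of that error.

  The device for this (\<open>resolvent_point_exists\<close>) is to solve \<open>w = v + s (x - \<theta>(w, p))\<close> for \<open>w\<close> near
  \<open>v\<close>. As \<open>\<theta>\<close> is monotone and Lipschitz, \<open>w + s \<theta>(w, p)\<close> is strongly monotone and Lipschitz in \<open>w\<close>, so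
  the equation is a contraction problem. At the solution, \<open>w\<close> supports \<open>g(\<cdot>, p)\<close> at \<open>y = \<theta>(w, p)\<close>, and
  \<open>\<langle>w, x - y\<rangle> = \<langle>v, x - y\<rangle> + s \<parallel>x - y\<parallel>\<^sup>2\<close>: for large \<open>s\<close> the tilt towards \<open>x\<close> beats the error
  \<open>r/2 \<parallel>x - y\<parallel>\<^sup>2\<close>. It is used in both directions.

  \<^item> From minimizers to solutions: if \<open>x\<close> has the subgradient \<open>v\<close>, comparing the supports at \<open>x\<close> and
    \<open>y\<close> forces \<open>x = y\<close> and hence \<open>w = v\<close> and \<open>x = M\<^sub>\<gamma>(v, p)\<close> (\<open>support_point_unique\<close>). The strengthened
    Lipschitz estimate of the solution map amounts to strong monotonicity of the inverse of \<open>M\<^sub>\<gamma>(\<cdot>, p)\<close>,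
    which follows from the quadratic growth that Lipschitz dependence of minimizers on tilts entails
    (\<open>quadratic_growth_of_lipschitz_minimizers\<close>). The Lipschitz-like epigraphs guarantee that \<open>g(\<cdot>, p)\<close>
    takes finite values near \<open>xbar\<close>, so that the minima are finite.

  \<^item> From solutions to minimizers: along the range of \<open>\<theta>(\<cdot>, p)\<close> the error \<open>r/2 \<parallel>x - u\<parallel>\<^sup>2\<close> vanishes,
    since subdividing the segment between two tilts makes the accumulated error arbitrarily small
    (\<open>no_defect_along_monotone_map\<close>). A point \<open>x\<close> outside the range is compared first with \<open>y\<close>
    as above, and \<open>y\<close> then with \<open>\<theta>(v, p)\<close> within the range
    (\<open>prox_subgradients_become_subgradients\<close>). This gives minimality together with existence of the
    minimizer, and \<open>support_point_unique\<close> gives uniqueness.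
\<close>

section \<open>Quadratic supports\<close>

text \<open>
  One notion covers all the first-order inequalities at issue: \<open>v\<close> is a proximal subgradient on \<open>U\<close> for
  \<open>r > 0\<close>, \<open>u\<close> minimizes \<open>\<phi> - \<langle>v, \<cdot>\<rangle>\<close> over \<open>U\<close> for \<open>r = 0\<close> and \<open>u \<in> U\<close>, and the minimum
  satisfies a quadratic growth condition for \<open>r < 0\<close>.
\<close>

definition supports_on ::
    "'a::real_inner set \<Rightarrow> real \<Rightarrow> ('a \<Rightarrow> ereal) \<Rightarrow> 'a \<Rightarrow> 'a \<Rightarrow> bool" where
  "supports_on U r \<phi> u v \<longleftrightarrow> \<bar>\<phi> u\<bar> \<noteq> \<infinity> \<and>
     (\<forall>x\<in>U. \<phi> u + ereal (v \<bullet> (x - u) - r / 2 * (norm (x - u))\<^sup>2) \<le> \<phi> x)"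

lemma supports_on_real:
  assumes "supports_on U r \<phi> u v" "x \<in> U" "\<bar>\<phi> x\<bar> \<noteq> \<infinity>"
  shows "real_of_ereal (\<phi> u) + v \<bullet> (x - u) - r / 2 * (norm (x - u))\<^sup>2 \<le> real_of_ereal (\<phi> x)"
proof -
  obtain a b where "\<phi> u = ereal a" "\<phi> x = ereal b"
    using assms unfolding supports_on_def by (metis ereal_real')
  moreover have "\<phi> u + ereal (v \<bullet> (x - u) - r / 2 * (norm (x - u))\<^sup>2) \<le> \<phi> x"
    using assms unfolding supports_on_def by blast
  ultimately show ?thesis by simp
qed

lemma supports_on_subset: "supports_on U r \<phi> u v \<Longrightarrow> U' \<subseteq> U \<Longrightarrow> supports_on U' r \<phi> u v"
  unfolding supports_on_def by auto

text \<open>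
  A minimizer over a set containing \<open>u\<close> does at least as well as \<open>u\<close>, and so inherits from \<open>u\<close> the
  minimality over any other set.
\<close>

lemma supports_on_transfer:
  assumes "supports_on U 0 \<phi> u v" "supports_on U' 0 \<phi> x v" "u \<in> U'"
  shows "supports_on U 0 \<phi> x v"
proof -
  have fin: "\<bar>\<phi> u\<bar> \<noteq> \<infinity>" "\<bar>\<phi> x\<bar> \<noteq> \<infinity>"
    using assms(1,2) unfolding supports_on_def by auto
  have "\<phi> x + ereal (v \<bullet> (y - x)) \<le> \<phi> u + ereal (v \<bullet> (y - u))" for y
    using supports_on_real[OF assms(2,3) fin(1)] fin
    by (cases "\<phi> u"; cases "\<phi> x") (auto simp: inner_diff_right)
  then show ?thesis
    using assms(1,2) unfolding supports_on_def by (auto intro: order_trans)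
qed

text \<open>
  Adding the two supports, each evaluated at the base point of the other, cancels the function values.
  Depending on the sign of \<open>r + s\<close> this is hypomonotonicity, monotonicity or strong monotonicity.
\<close>

lemma supports_on_monotone:
  assumes "supports_on U r \<phi> u v" "supports_on U' s \<phi> x w" "x \<in> U" "u \<in> U'"
  shows "- ((r + s) / 2) * (norm (u - x))\<^sup>2 \<le> (v - w) \<bullet> (u - x)"
proof -
  have fin: "\<bar>\<phi> u\<bar> \<noteq> \<infinity>" "\<bar>\<phi> x\<bar> \<noteq> \<infinity>"
    using assms(1,2) unfolding supports_on_def by auto
  show ?thesis
    using supports_on_real[OF assms(1) assms(3) fin(2)] supports_on_real[OF assms(2) assms(4) fin(1)]
    by (simp add: inner_diff_left inner_diff_right norm_minus_commute algebra_simps add_divide_distrib)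
qed

section \<open>The perturbed tilt equation\<close>

text \<open>
  With \<open>R(w) = w - v - s (x - T w)\<close>, which is 1-strongly monotone with Lipschitz constant \<open>L = 1 + s K\<close>,
  the damped iteration \<open>w \<mapsto> w - R(w) / L\<^sup>2\<close> contracts the ball with factor \<open>1 - 1 / (2 L\<^sup>2)\<close>. It moves
  the centre by \<open>s \<parallel>x - T v\<parallel> / L\<^sup>2\<close>, which \<open>close\<close> bounds by exactly the slack \<open>\<delta> / (2 L\<^sup>2)\<close> that the
  contraction leaves, so the ball is mapped into itself.
\<close>

lemma resolvent_point_exists:
  fixes T :: "'x::{real_inner, complete_space} \<Rightarrow> 'x"
  assumes "0 < \<delta>" "0 \<le> K" "0 \<le> s"
    and lip: "\<And>w w'. w \<in> cball v \<delta> \<Longrightarrow> w' \<in> cball v \<delta> \<Longrightarrow> norm (T w - T w') \<le> K * norm (w - w')"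
    and mono: "\<And>w w'. w \<in> cball v \<delta> \<Longrightarrow> w' \<in> cball v \<delta> \<Longrightarrow> 0 \<le> (w - w') \<bullet> (T w - T w')"
    and close: "s * norm (x - T v) \<le> \<delta> / 2"
  obtains w where "w \<in> cball v \<delta>" "w = v + s *\<^sub>R (x - T w)"
proof -
  define L where "L = 1 + s * K"
  define \<tau> where "\<tau> = 1 / L\<^sup>2"
  define f where "f w = w - \<tau> *\<^sub>R (w - v - s *\<^sub>R (x - T w))" for w
  have L: "1 \<le> L" using assms unfolding L_def by simp
  then have tau: "0 < \<tau>" "\<tau> \<le> 1" "\<tau> * L\<^sup>2 = 1"
    unfolding \<tau>_def by (auto simp: divide_simps)
  have contr: "dist (f w) (f w') \<le> (1 - \<tau> / 2) * dist w w'"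
    if w: "w \<in> cball v \<delta>" "w' \<in> cball v \<delta>" for w w'
  proof -
    define a where "a = w - w'"
    define b where "b = a + s *\<^sub>R (T w - T w')"
    have eq: "f w - f w' = a - \<tau> *\<^sub>R b"
      unfolding f_def a_def b_def by (simp add: algebra_simps)
    have "norm b \<le> norm a + s * norm (T w - T w')"
      unfolding b_def using norm_triangle_ineq[of a "s *\<^sub>R (T w - T w')"] \<open>0 \<le> s\<close> by simp
    also have "\<dots> \<le> L * norm a"
      using mult_left_mono[OF lip[OF w] \<open>0 \<le> s\<close>] unfolding L_def a_def by (simp add: algebra_simps)
    finally have "(norm b)\<^sup>2 \<le> (L * norm a)\<^sup>2" by (intro power_mono) auto
    then have nb: "\<tau> * (norm b)\<^sup>2 \<le> (norm a)\<^sup>2"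
      using mult_left_mono[of "(norm b)\<^sup>2" "(L * norm a)\<^sup>2" \<tau>] tau
      by (simp add: power_mult_distrib mult.assoc[symmetric])
    have ab: "(norm a)\<^sup>2 \<le> a \<bullet> b"
      using mult_nonneg_nonneg[OF \<open>0 \<le> s\<close> mono[OF w]]
      unfolding b_def a_def[symmetric] by (simp add: inner_add_right power2_norm_eq_inner)
    have "(norm (a - \<tau> *\<^sub>R b))\<^sup>2 = (norm a)\<^sup>2 - 2 * \<tau> * (a \<bullet> b) + \<tau> * (\<tau> * (norm b)\<^sup>2)"
      unfolding power2_norm_eq_inner
      by (simp add: inner_diff_left inner_diff_right inner_commute algebra_simps)
    also have "\<dots> \<le> (norm a)\<^sup>2 - 2 * \<tau> * (norm a)\<^sup>2 + \<tau> * (norm a)\<^sup>2"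
      using mult_left_mono[OF nb, of \<tau>] mult_left_mono[OF ab, of "2 * \<tau>"] tau by linarith
    also have "\<dots> \<le> ((1 - \<tau> / 2) * norm a)\<^sup>2"
      using tau(1) by (simp add: power2_eq_square algebra_simps)
    finally have "norm (a - \<tau> *\<^sub>R b) \<le> (1 - \<tau> / 2) * norm a"
      by (rule power2_le_imp_le) (use tau in simp)
    then show ?thesis unfolding dist_norm eq a_def .
  qed
  have self: "f w \<in> cball v \<delta>" if w: "w \<in> cball v \<delta>" for w
  proof -
    have v: "v \<in> cball v \<delta>" using \<open>0 < \<delta>\<close> by simp
    have "dist v (f v) = \<tau> * (s * norm (x - T v))"
      unfolding f_def dist_norm using tau \<open>0 \<le> s\<close> by simp
    also have "\<dots> \<le> \<tau> * (\<delta> / 2)" using close tau by (intro mult_left_mono) auto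
    finally have 1: "dist v (f v) \<le> \<tau> * (\<delta> / 2)" .
    have "dist (f v) (f w) \<le> (1 - \<tau> / 2) * dist v w" by (rule contr[OF v w])
    also have "\<dots> \<le> (1 - \<tau> / 2) * \<delta>" using w tau by (intro mult_left_mono) auto
    finally have "dist v (f w) \<le> \<tau> * (\<delta> / 2) + (1 - \<tau> / 2) * \<delta>"
      using 1 dist_triangle[of v "f w" "f v"] by linarith
    also have "\<dots> = \<delta>" by (simp add: algebra_simps)
    finally show ?thesis by simp
  qed
  have "\<exists>!w\<in>cball v \<delta>. f w = w"
  proof (rule Banach_fix[where c = "1 - \<tau> / 2"])
    show "complete (cball v \<delta>)" by (simp add: complete_eq_closed)
    show "cball v \<delta> \<noteq> {}" using \<open>0 < \<delta>\<close> by simp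
  qed (use tau self contr in auto)
  then obtain w where w: "w \<in> cball v \<delta>" "f w = w" by blast
  then have "w - v - s *\<^sub>R (x - T w) = 0"
    using tau unfolding f_def by simp
  then have "w = v + s *\<^sub>R (x - T w)" by (simp add: algebra_simps)
  with w(1) show thesis by (rule that)
qed

text \<open>
  Solving the tilt equation with the weight \<open>r\<close> gives \<open>w - v = r (x - T w)\<close>; such a strongly decreasing
  relation between tilts and base points contradicts \<open>supports_on_monotone\<close> unless \<open>x = T w\<close>, in
  which case \<open>w = v\<close>.
\<close>

lemma support_point_unique:
  fixes T :: "'x::{real_inner, complete_space} \<Rightarrow> 'x"
  assumes "0 < \<delta>" "0 \<le> K" "0 < r" "r1 + r2 \<le> r"
    and lip: "\<And>w w'. w \<in> cball v \<delta> \<Longrightarrow> w' \<in> cball v \<delta> \<Longrightarrow> norm (T w - T w') \<le> K * norm (w - w')"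
    and mono: "\<And>w w'. w \<in> cball v \<delta> \<Longrightarrow> w' \<in> cball v \<delta> \<Longrightarrow> 0 \<le> (w - w') \<bullet> (T w - T w')"
    and close: "r * norm (x - T v) \<le> \<delta> / 2"
    and T: "\<And>w. w \<in> cball v \<delta> \<Longrightarrow> supports_on U r1 \<phi> (T w) w"
    and TU: "\<And>w. w \<in> cball v \<delta> \<Longrightarrow> T w \<in> U'"
    and x: "supports_on U' r2 \<phi> x v" "x \<in> U"
  shows "x = T v"
proof -
  obtain w where w: "w \<in> cball v \<delta>" "w = v + r *\<^sub>R (x - T w)"
    using resolvent_point_exists[OF assms(1,2) _ lip mono close] \<open>0 < r\<close> by (metis less_imp_le)
  have "- ((r1 + r2) / 2) * (norm (T w - x))\<^sup>2 \<le> (w - v) \<bullet> (T w - x)"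
    by (rule supports_on_monotone[OF T[OF w(1)] x(1) x(2) TU[OF w(1)]])
  also have "w - v = - r *\<^sub>R (T w - x)"
    using w(2) by (metis add_diff_cancel_left' minus_diff_eq scaleR_minus_left scaleR_minus_right)
  also have "- r *\<^sub>R (T w - x) \<bullet> (T w - x) = - r * (norm (T w - x))\<^sup>2"
    by (simp add: power2_norm_eq_inner)
  finally have "(r - (r1 + r2) / 2) * (norm (T w - x))\<^sup>2 \<le> 0"
    by (simp add: algebra_simps)
  moreover have "0 < r - (r1 + r2) / 2" using assms(3,4) by (simp add: field_simps)
  ultimately have "(norm (T w - x))\<^sup>2 \<le> 0" by (simp add: mult_le_0_iff)
  then have "T w = x" by simp
  with w(2) show ?thesis by simp
qed

section \<open>From proximal subgradients to minimizers\<close>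

text \<open>
  Going through the midpoint of \<open>w\<close> and \<open>w'\<close> replaces one error \<open>c \<parallel>w' - w\<parallel>\<^sup>2\<close> by two errors of a quarter
  of that size, while the change of slope at the midpoint contributes a term that is nonnegative by monotonicity.
\<close>

lemma midpoint_improvement:
  fixes T :: "'x::real_inner \<Rightarrow> 'x"
  assumes "convex C"
    and mono: "\<And>w w'. w \<in> C \<Longrightarrow> w' \<in> C \<Longrightarrow> 0 \<le> (w - w') \<bullet> (T w - T w')"
    and sub: "\<And>w w'. w \<in> C \<Longrightarrow> w' \<in> C \<Longrightarrow>
                F w + w \<bullet> (T w' - T w) - c * (norm (w' - w))\<^sup>2 \<le> F w'"
    and w: "w \<in> C" "w' \<in> C"
  shows "F w + w \<bullet> (T w' - T w) - c / 2 * (norm (w' - w))\<^sup>2 \<le> F w'"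
proof -
  define a where "a = (1/2) *\<^sub>R (w' - w)"
  define m where "m = w + a"
  have "m = (1/2) *\<^sub>R w + (1/2) *\<^sub>R w'"
    unfolding m_def a_def by (simp add: algebra_simps flip: scaleR_left_distrib)
  then have m: "m \<in> C" using convexD[OF assms(1) w, of "1/2" "1/2"] by simp
  have am: "m - w = a" "w' - m = a"
    unfolding m_def a_def by (simp_all add: algebra_simps flip: scaleR_left_distrib)
  have na: "(norm (w' - w))\<^sup>2 = 4 * (norm a)\<^sup>2"
    unfolding a_def by (simp add: power_divide)
  have 1: "F w + w \<bullet> (T m - T w) - c * (norm a)\<^sup>2 \<le> F m" using sub[OF w(1) m] am by simp
  have 2: "F m + m \<bullet> (T w' - T m) - c * (norm a)\<^sup>2 \<le> F w'" using sub[OF m w(2)] am by simp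
  have "0 \<le> a \<bullet> (T w' - T m)" using mono[OF w(2) m] am by simp
  moreover have "m \<bullet> (T w' - T m) = w \<bullet> (T w' - T m) + a \<bullet> (T w' - T m)"
    unfolding m_def by (simp add: inner_add_left)
  moreover have "w \<bullet> (T w' - T w) = w \<bullet> (T w' - T m) + w \<bullet> (T m - T w)"
    by (simp add: inner_diff_right)
  ultimately show ?thesis using 1 2 na by simp
qed

lemma no_defect_along_monotone_map:
  fixes T :: "'x::real_inner \<Rightarrow> 'x"
  assumes "convex C"
    and mono: "\<And>w w'. w \<in> C \<Longrightarrow> w' \<in> C \<Longrightarrow> 0 \<le> (w - w') \<bullet> (T w - T w')"
    and sub: "\<And>w w'. w \<in> C \<Longrightarrow> w' \<in> C \<Longrightarrow>
                F w + w \<bullet> (T w' - T w) - c * (norm (w' - w))\<^sup>2 \<le> F w'"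
    and w: "w \<in> C" "w' \<in> C"
  shows "F w + w \<bullet> (T w' - T w) \<le> F w'"
proof -
  have halved: "\<And>w w'. w \<in> C \<Longrightarrow> w' \<in> C \<Longrightarrow>
      F w + w \<bullet> (T w' - T w) - c * (1 / 2) ^ n * (norm (w' - w))\<^sup>2 \<le> F w'" for n
  proof (induction n)
    case (Suc n)
    show ?case using midpoint_improvement[OF assms(1) mono Suc.IH Suc.prems] by simp
  qed (use sub in simp)
  have "(\<lambda>n. c * (1 / 2) ^ n * (norm (w' - w))\<^sup>2) \<longlonglongrightarrow> c * 0 * (norm (w' - w))\<^sup>2"
    by (intro tendsto_mult tendsto_const LIMSEQ_power_zero) simp
  from tendsto_diff[OF tendsto_const[of "F w + w \<bullet> (T w' - T w)"] this]
  have "(\<lambda>n. F w + w \<bullet> (T w' - T w) - c * (1 / 2) ^ n * (norm (w' - w))\<^sup>2)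
      \<longlonglongrightarrow> F w + w \<bullet> (T w' - T w)"
    by simp
  then show ?thesis using halved[OF w] by (intro LIMSEQ_le_const2[of _ _ "F w'"]) auto
qed

text \<open>
  The conclusion includes the points \<open>T w\<close>, which may lie outside \<open>U'\<close>: the uniqueness argument
  needs the values there too.
\<close>

lemma prox_subgradients_become_subgradients:
  fixes T :: "'x::{real_inner, complete_space} \<Rightarrow> 'x"
  assumes "0 < \<delta>" "0 \<le> K" "0 < r"
    and lip: "\<And>w w'. w \<in> cball v \<delta> \<Longrightarrow> w' \<in> cball v \<delta> \<Longrightarrow> norm (T w - T w') \<le> K * norm (w - w')"
    and mono: "\<And>w w'. w \<in> cball v \<delta> \<Longrightarrow> w' \<in> cball v \<delta> \<Longrightarrow> 0 \<le> (w - w') \<bullet> (T w - T w')"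
    and T: "\<And>w. w \<in> cball v \<delta> \<Longrightarrow> supports_on U r \<phi> (T w) w"
    and TU: "\<And>w. w \<in> cball v \<delta> \<Longrightarrow> T w \<in> U"
    and U': "U' \<subseteq> U" "\<And>x. x \<in> U' \<Longrightarrow> r * norm (x - T v) \<le> \<delta> / 2"
  shows "supports_on (U' \<union> T ` cball v \<delta>) 0 \<phi> (T v) v"
proof -
  define F where "F w = real_of_ereal (\<phi> (T w))" for w
  have vin: "v \<in> cball v \<delta>" using \<open>0 < \<delta>\<close> by simp
  have fin: "\<bar>\<phi> (T w)\<bar> \<noteq> \<infinity>" if "w \<in> cball v \<delta>" for w
    using T[OF that] unfolding supports_on_def by simp
  have F: "\<phi> (T w) = ereal (F w)" if "w \<in> cball v \<delta>" for w
    unfolding F_def using fin[OF that] by (simp add: ereal_real)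
  \<comment> \<open>By the Lipschitz bound, the proximal error is also quadratic in the tilts.\<close>
  have sub: "F w + w \<bullet> (T w' - T w) - r / 2 * K\<^sup>2 * (norm (w' - w))\<^sup>2 \<le> F w'"
    if w: "w \<in> cball v \<delta>" "w' \<in> cball v \<delta>" for w w'
  proof -
    have "(norm (T w' - T w))\<^sup>2 \<le> (K * norm (w' - w))\<^sup>2"
      using lip[OF w(2,1)] by (intro power_mono) auto
    then have "r / 2 * (norm (T w' - T w))\<^sup>2 \<le> r / 2 * K\<^sup>2 * (norm (w' - w))\<^sup>2"
      using mult_left_mono[of _ _ "r / 2"] \<open>0 < r\<close> by (simp add: power_mult_distrib)
    then show ?thesis
      using supports_on_real[OF T[OF w(1)] TU[OF w(2)] fin[OF w(2)]] unfolding F_def by linarith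
  qed
  have conv: "F v + v \<bullet> (T w - T v) \<le> F w" if "w \<in> cball v \<delta>" for w
    by (rule no_defect_along_monotone_map[OF convex_cball mono sub vin that])
  have "\<phi> (T v) + ereal (v \<bullet> (x - T v)) \<le> \<phi> x" if x: "x \<in> U'" for x
  proof -
    obtain w where w: "w \<in> cball v \<delta>" "w = v + r *\<^sub>R (x - T w)"
      using resolvent_point_exists[OF assms(1,2) _ lip mono U'(2)[OF x]] \<open>0 < r\<close>
      by (metis less_imp_le)
    have "w \<bullet> (x - T w) = v \<bullet> (x - T w) + r * (norm (x - T w))\<^sup>2"
      by (subst w(2)) (simp add: inner_add_left power2_norm_eq_inner)
    moreover have "0 \<le> r * (norm (x - T w))\<^sup>2" using \<open>0 < r\<close> by simp
    moreover have "v \<bullet> (x - T v) = v \<bullet> (x - T w) + v \<bullet> (T w - T v)"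
      by (simp add: inner_diff_right)
    \<comment> \<open>The gain \<open>r \<parallel>x - T w\<parallel>\<^sup>2\<close> from the tilt outweighs half of it lost in the support at \<open>T w\<close>.\<close>
    ultimately have "F v + v \<bullet> (x - T v) \<le> F w + (w \<bullet> (x - T w) - r / 2 * (norm (x - T w))\<^sup>2)"
      using conv[OF w(1)] by simp
    then have "\<phi> (T v) + ereal (v \<bullet> (x - T v))
        \<le> \<phi> (T w) + ereal (w \<bullet> (x - T w) - r / 2 * (norm (x - T w))\<^sup>2)"
      using F[OF vin] F[OF w(1)] by simp
    also have "\<dots> \<le> \<phi> x" using T[OF w(1)] x U'(1) unfolding supports_on_def by blast
    finally show ?thesis .
  qed
  moreover have "\<phi> (T v) + ereal (v \<bullet> (T w - T v)) \<le> \<phi> (T w)" if "w \<in> cball v \<delta>" for w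
    using conv[OF that] F[OF vin] F[OF that] by simp
  ultimately show ?thesis using fin[OF vin] unfolding supports_on_def by auto
qed

section \<open>Quadratic growth from Lipschitz minimizers\<close>

text \<open>
  Test the minimality of \<open>T w\<close> for the tilt \<open>w = v + t (x - T v)\<close> at \<open>x\<close>. The tilt gains
  \<open>t \<parallel>x - T v\<parallel>\<^sup>2\<close>, and moving the minimizer from \<open>T v\<close> to \<open>T w\<close> costs at most \<open>K t\<^sup>2 \<parallel>x - T v\<parallel>\<^sup>2\<close>. The
  choice \<open>t = 1 / (2 K)\<close> maximizes the difference, leaving \<open>\<parallel>x - T v\<parallel>\<^sup>2 / (4 K)\<close>.
\<close>

lemma quadratic_growth_of_lipschitz_minimizers:
  assumes "0 < K" "0 \<le> \<delta>"
    and lip: "\<And>w. w \<in> cball v \<delta> \<Longrightarrow> norm (T w - T v) \<le> K * norm (w - v)"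
    and T: "\<And>w. w \<in> cball v \<delta> \<Longrightarrow> supports_on U 0 \<phi> (T w) w"
    and TU: "\<And>w. w \<in> cball v \<delta> \<Longrightarrow> T w \<in> U"
    and U': "U' \<subseteq> U" "\<And>x. x \<in> U' \<Longrightarrow> norm (x - T v) \<le> 2 * K * \<delta>"
  shows "supports_on U' (- (1 / (2 * K))) \<phi> (T v) v"
proof -
  have vin: "v \<in> cball v \<delta>" using \<open>0 \<le> \<delta>\<close> by simp
  have "\<phi> (T v) + ereal (v \<bullet> (x - T v) - - (1 / (2 * K)) / 2 * (norm (x - T v))\<^sup>2) \<le> \<phi> x"
    if x: "x \<in> U'" for x
  proof -
    define a where "a = (1 / (2 * K)) *\<^sub>R (x - T v)"
    define w where "w = v + a"
    have w: "w \<in> cball v \<delta>"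
    proof -
      have "norm a \<le> \<delta>" unfolding a_def using U'(2)[OF x] \<open>0 < K\<close> by (simp add: divide_le_eq mult.commute mult.left_commute)
      then show ?thesis unfolding w_def by (simp add: dist_norm)
    qed
    have xa: "x - T v = (2 * K) *\<^sub>R a" unfolding a_def using \<open>0 < K\<close> by simp
    have n: "(norm (x - T v))\<^sup>2 = 4 * K\<^sup>2 * (norm a)\<^sup>2"
      unfolding xa using \<open>0 < K\<close> by (simp add: power_mult_distrib)
    have fin: "\<bar>\<phi> (T w)\<bar> \<noteq> \<infinity>" "\<bar>\<phi> (T v)\<bar> \<noteq> \<infinity>"
      using T[OF w] T[OF vin] unfolding supports_on_def by auto
    define A B where "A = real_of_ereal (\<phi> (T v))" and "B = real_of_ereal (\<phi> (T w))"
    have AB: "\<phi> (T v) = ereal A" "\<phi> (T w) = ereal B"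
      unfolding A_def B_def using fin by (simp_all add: ereal_real)
    have 1: "A + v \<bullet> (T w - T v) \<le> B"
      using supports_on_real[OF T[OF vin] TU[OF w] fin(1)] unfolding A_def B_def by simp
    have "a \<bullet> (T w - T v) \<le> norm a * norm (T w - T v)" by (rule norm_cauchy_schwarz)
    also have "\<dots> \<le> norm a * (K * norm a)"
      using lip[OF w] unfolding w_def by (intro mult_left_mono) auto
    finally have 2: "a \<bullet> (T w - T v) \<le> K * (norm a)\<^sup>2" by (simp add: power2_eq_square algebra_simps)
    have 3: "a \<bullet> (x - T v) = 2 * K * (norm a)\<^sup>2" unfolding xa by (simp add: power2_norm_eq_inner)
    have "w \<bullet> (x - T w) = v \<bullet> (x - T v) - v \<bullet> (T w - T v) + a \<bullet> (x - T v) - a \<bullet> (T w - T v)"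
      unfolding w_def by (simp add: inner_add_left inner_diff_right)
    moreover have "1 / (2 * K) / 2 * (norm (x - T v))\<^sup>2 = K * (norm a)\<^sup>2"
      unfolding n using \<open>0 < K\<close> by (simp add: power2_eq_square)
    ultimately have "A + (v \<bullet> (x - T v) - - (1 / (2 * K)) / 2 * (norm (x - T v))\<^sup>2)
        \<le> B + w \<bullet> (x - T w)"
      using 1 2 3 by simp
    then have "\<phi> (T v) + ereal (v \<bullet> (x - T v) - - (1 / (2 * K)) / 2 * (norm (x - T v))\<^sup>2)
        \<le> \<phi> (T w) + ereal (w \<bullet> (x - T w))"
      unfolding AB by simp
    also have "\<dots> \<le> \<phi> x" using T[OF w] x U'(1) unfolding supports_on_def by auto
    finally show ?thesis .
  qed
  then show ?thesis using T[OF vin] unfolding supports_on_def by auto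
qed

section \<open>Supports and the notions of the statement\<close>

text \<open>
  The finite value \<open>\<phi> z\<close> matters: if \<open>\<phi>\<close> is \<open>\<infinity>\<close> on all of \<open>B\<close>, then every point of \<open>B\<close> is a minimizer in
  the sense of \<^const>\<open>is_arg_min\<close>, but none is a base point of a support.
\<close>

lemma is_arg_min_iff_supports_on:
  assumes "\<And>x. \<phi> x \<noteq> -\<infinity>" "z \<in> B" "\<phi> z \<noteq> \<infinity>"
  shows "is_arg_min (\<lambda>x. \<phi> x - ereal (v \<bullet> x)) (\<lambda>x. x \<in> B) u \<longleftrightarrow> u \<in> B \<and> supports_on B 0 \<phi> u v"
proof -
  have le: "\<phi> u - ereal (v \<bullet> u) \<le> \<phi> x - ereal (v \<bullet> x) \<longleftrightarrow> \<phi> u + ereal (v \<bullet> (x - u)) \<le> \<phi> x"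
    if "\<phi> u \<noteq> \<infinity>" for x
    using that assms(1)[of u] assms(1)[of x]
    by (cases "\<phi> u"; cases "\<phi> x") (auto simp: inner_diff_right algebra_simps)
  have "\<phi> u \<noteq> \<infinity>" if "\<phi> u - ereal (v \<bullet> u) \<le> \<phi> z - ereal (v \<bullet> z)"
    using that assms(3) assms(1)[of z] by (cases "\<phi> u"; cases "\<phi> z") auto
  then show ?thesis
    using le assms unfolding is_arg_min_def supports_on_def not_less[symmetric]
    by (auto simp: not_less)
qed

lemma partial_subdiff_if_supports_on:
  assumes "supports_on U 0 (\<lambda>x. g x p) u v" "u \<in> interior U"
  shows "v \<in> partial_subdiff g u p"
proof -
  let ?\<phi> = "\<lambda>x. g x p"
  have fin: "\<bar>g u p\<bar> \<noteq> \<infinity>" using assms(1) unfolding supports_on_def by simp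
  have "\<forall>\<^sub>F y in at u. y \<in> U"
    using assms(2) by (metis eventually_at_topological interior_subset open_interior subsetD)
  then have "\<forall>\<^sub>F y in at u. 0 \<le> (g y p - g u p - ereal (v \<bullet> (y - u))) / ereal (norm (y - u))"
  proof eventually_elim
    case (elim y)
    then have "g u p + ereal (v \<bullet> (y - u)) \<le> g y p"
      using assms(1) unfolding supports_on_def by simp
    then have "0 \<le> g y p - g u p - ereal (v \<bullet> (y - u))"
      using fin by (cases "g u p"; cases "g y p") auto
    then show ?case
      by (cases "y = u") (auto intro: zero_le_divide_ereal)
  qed
  then have "v \<in> regular_subdiff ?\<phi> u"
    unfolding regular_subdiff_def using fin by (auto intro: Liminf_bounded)
  then have "(\<lambda>_. u) \<longlonglongrightarrow> u \<and> (\<lambda>k. ?\<phi> u) \<longlonglongrightarrow> ?\<phi> u \<and>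
      (\<forall>k::nat. v \<in> regular_subdiff ?\<phi> u) \<and> weakly_convergent_to (\<lambda>_. v) v"
    unfolding weakly_convergent_to_def by simp
  then have "v \<in> limiting_subdiff ?\<phi> u"
    unfolding limiting_subdiff_def mem_Collect_eq using fin
    by (intro conjI exI[of _ "\<lambda>_. u"] exI[of _ "\<lambda>_. v"]) auto
  then show ?thesis unfolding partial_subdiff_def .
qed

text \<open>
  Continuity of \<open>g\<close> along the graph of its subdifferential makes the restriction
  \<open>g u p \<le> g xbar pbar + \<epsilon>\<close> in the definition of prox-regularity automatic near the reference point.
\<close>

lemma prox_regular_supports_on:
  fixes g :: "'x::real_inner \<Rightarrow> 'p::metric_space \<Rightarrow> ereal"
  assumes "param_cont_prox_regular g xbar pbar vbar" "vbar \<in> partial_subdiff g xbar pbar"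
  obtains \<rho> r where "0 < \<rho>" "0 < r"
    "\<And>u p v. u \<in> cball xbar \<rho> \<Longrightarrow> p \<in> cball pbar \<rho> \<Longrightarrow> v \<in> cball vbar \<rho> \<Longrightarrow>
       v \<in> partial_subdiff g u p \<Longrightarrow> supports_on (cball xbar \<rho>) r (\<lambda>x. g x p) u v"
proof -
  have fin_sub: "\<bar>g u p\<bar> \<noteq> \<infinity>" if "v \<in> partial_subdiff g u p" for u p v
    using that unfolding partial_subdiff_def limiting_subdiff_def by simp
  obtain U V Q \<epsilon> r where "0 < \<epsilon>" "0 < r"
    and int: "xbar \<in> interior U" "vbar \<in> interior V" "pbar \<in> interior Q"
    and prox: "\<And>u p v x. u \<in> U \<Longrightarrow> p \<in> Q \<Longrightarrow> v \<in> partial_subdiff g u p \<Longrightarrow> v \<in> V \<Longrightarrow>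
       g u p \<le> g xbar pbar + ereal \<epsilon> \<Longrightarrow> x \<in> U \<Longrightarrow>
       g u p + ereal (v \<bullet> (x - u)) - ereal (r / 2 * (norm (x - u))\<^sup>2) \<le> g x p"
    and cont: "continuous (at (xbar, pbar, vbar) within gph_partial_subdiff g) (\<lambda>(x, p, v). g x p)"
    using assms(1) unfolding param_cont_prox_regular_def by fast
  have "g xbar pbar < g xbar pbar + ereal \<epsilon>"
    using fin_sub[OF assms(2)] \<open>0 < \<epsilon>\<close> by (cases "g xbar pbar") auto
  then have "\<forall>\<^sub>F z in at (xbar, pbar, vbar) within gph_partial_subdiff g.
      (\<lambda>(x, p, v). g x p) z < g xbar pbar + ereal \<epsilon>"
    using order_tendstoD(2)[OF cont[unfolded continuous_within]] by simp
  then obtain N where N: "open N" "(xbar, pbar, vbar) \<in> N"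
    "\<And>z. z \<in> N \<Longrightarrow> z \<noteq> (xbar, pbar, vbar) \<Longrightarrow> z \<in> gph_partial_subdiff g \<Longrightarrow>
       (\<lambda>(x, p, v). g x p) z < g xbar pbar + ereal \<epsilon>"
    unfolding eventually_at_topological by blast
  \<comment> \<open>The limit says nothing about the reference point itself, where the bound holds by the choice of \<open>\<epsilon>\<close>.\<close>
  have Nle: "g u p \<le> g xbar pbar + ereal \<epsilon>" if "(u, p, v) \<in> N" "v \<in> partial_subdiff g u p" for u p v
  proof (cases "(u, p, v) = (xbar, pbar, vbar)")
    case True
    then show ?thesis using \<open>g xbar pbar < g xbar pbar + ereal \<epsilon>\<close> by auto
  next
    case False
    then show ?thesis using N(3)[OF that(1)] that(2) unfolding gph_partial_subdiff_def by auto
  qed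
  obtain A D where AD: "open A" "open D" "(xbar, pbar, vbar) \<in> A \<times> D" "A \<times> D \<subseteq> N"
    using open_prod_elim[OF N(1,2)] by blast
  then have "(pbar, vbar) \<in> D" by simp
  then obtain B C where BC: "open B" "open C" "(pbar, vbar) \<in> B \<times> C" "B \<times> C \<subseteq> D"
    using open_prod_elim[OF AD(2)] by blast
  have ABC: "open A" "open B" "open C" "xbar \<in> A" "pbar \<in> B" "vbar \<in> C" "A \<times> B \<times> C \<subseteq> N"
    using AD BC by auto
  obtain a where a: "0 < a" "cball xbar a \<subseteq> interior U \<inter> A"
    using ABC int open_Int open_interior by (metis IntI open_contains_cball)
  obtain b where b: "0 < b" "cball pbar b \<subseteq> interior Q \<inter> B"
    using ABC int open_Int open_interior by (metis IntI open_contains_cball)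
  obtain c where c: "0 < c" "cball vbar c \<subseteq> interior V \<inter> C"
    using ABC int open_Int open_interior by (metis IntI open_contains_cball)
  define \<rho> where "\<rho> = min a (min b c)"
  have "cball xbar \<rho> \<subseteq> cball xbar a" "cball pbar \<rho> \<subseteq> cball pbar b" "cball vbar \<rho> \<subseteq> cball vbar c"
    unfolding \<rho>_def by (simp_all add: subset_cball)
  then have sub: "cball xbar \<rho> \<subseteq> U \<inter> A" "cball pbar \<rho> \<subseteq> Q \<inter> B" "cball vbar \<rho> \<subseteq> V \<inter> C"
    using a(2) b(2) c(2) interior_subset[of U] interior_subset[of V] interior_subset[of Q] by blast+
  show thesis
  proof (rule that)
    show "0 < \<rho>" "0 < r" using a b c \<open>0 < r\<close> unfolding \<rho>_def by auto
    fix u p v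
    assume *: "u \<in> cball xbar \<rho>" "p \<in> cball pbar \<rho>" "v \<in> cball vbar \<rho>" "v \<in> partial_subdiff g u p"
    have "(u, p, v) \<in> N" using * sub ABC(7) by blast
    then have le: "g u p \<le> g xbar pbar + ereal \<epsilon>" using Nle *(4) by blast
    have fin: "\<bar>g u p\<bar> \<noteq> \<infinity>" by (rule fin_sub[OF *(4)])
    have "g u p + ereal (v \<bullet> (x - u) - r / 2 * (norm (x - u))\<^sup>2) \<le> g x p" if "x \<in> cball xbar \<rho>" for x
    proof -
      have "g u p + ereal (v \<bullet> (x - u)) - ereal (r / 2 * (norm (x - u))\<^sup>2) \<le> g x p"
        by (rule prox[OF _ _ *(4) _ le]) (use * sub that in auto)
      then show ?thesis using fin by (cases "g u p") (auto simp: algebra_simps)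
    qed
    then show "supports_on (cball xbar \<rho>) r (\<lambda>x. g x p) u v"
      using fin unfolding supports_on_def by blast
  qed
qed

text \<open>The Lipschitz-like property moves \<open>(xbar, \<alpha>)\<close> to a nearby point of the epigraph for each nearby parameter.\<close>

lemma lipschitz_like_epi_finite_nearby:
  fixes g :: "'x::real_normed_vector \<Rightarrow> 'p::metric_space \<Rightarrow> ereal"
  assumes "lipschitz_like (\<lambda>p. epi (\<lambda>x. g x p)) pbar (xbar, \<alpha>)" "0 < \<gamma>"
  obtains \<eta> where "0 < \<eta>" "\<And>p. p \<in> cball pbar \<eta> \<Longrightarrow> \<exists>x\<in>cball xbar \<gamma>. g x p \<noteq> \<infinity>"
proof -
  obtain Q W l where "0 < l" "pbar \<in> interior Q" "(xbar, \<alpha>) \<in> interior W"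
    and base: "(xbar, \<alpha>) \<in> epi (\<lambda>x. g x pbar)"
    and incl: "\<And>p q. p \<in> Q \<Longrightarrow> q \<in> Q \<Longrightarrow> epi (\<lambda>x. g x p) \<inter> W
       \<subseteq> {y + (l * dist p q) *\<^sub>R b | y b. y \<in> epi (\<lambda>x. g x q) \<and> b \<in> cball 0 1}"
    using assms(1) unfolding lipschitz_like_def by auto
  obtain e where e: "0 < e" "cball pbar e \<subseteq> Q"
    using \<open>pbar \<in> interior Q\<close> by (auto simp: mem_interior_cball)
  have W: "(xbar, \<alpha>) \<in> W" using \<open>(xbar, \<alpha>) \<in> interior W\<close> interior_subset by blast
  show thesis
  proof (rule that)
    show "0 < min e (\<gamma> / l)" using e \<open>0 < l\<close> assms(2) by simp
    fix q assume q: "q \<in> cball pbar (min e (\<gamma> / l))"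
    then have "q \<in> Q" "pbar \<in> Q" using e by auto
    from incl[OF this(2,1)] base W obtain y b where
      y: "(xbar, \<alpha>) = y + (l * dist pbar q) *\<^sub>R b" "y \<in> epi (\<lambda>x. g x q)" "norm b \<le> 1"
      by auto
    have "g (fst y) q \<le> ereal (snd y)" using y(2) unfolding epi_def by auto
    then have fin: "g (fst y) q \<noteq> \<infinity>" by auto
    have "xbar - fst y = (l * dist pbar q) *\<^sub>R fst b"
      using arg_cong[OF y(1), of fst] by simp
    then have "dist xbar (fst y) = l * dist pbar q * norm (fst b)"
      using \<open>0 < l\<close> by (simp add: dist_norm)
    also have "\<dots> \<le> l * dist pbar q * 1"
      using \<open>0 < l\<close> norm_fst_le[of "fst b" "snd b"] y(3) by (intro mult_left_mono) auto
    also have "\<dots> \<le> \<gamma>" using q \<open>0 < l\<close> by (auto simp: field_simps)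
    finally have "fst y \<in> cball xbar \<gamma>" by simp
    with fin show "\<exists>x\<in>cball xbar \<gamma>. g x q \<noteq> \<infinity>" by blast
  qed
qed

section \<open>The two implications\<close>

text \<open>
  The scales for localizing a map with Lipschitz constant \<open>K\<close> in \<open>v\<close> and Hoelder constant \<open>l\<close> in \<open>p\<close>. Tilts
  range over the ball of radius \<open>\<delta>'\<close> and parameters over that of radius \<open>\<eta>\<close>, with values of the map
  within \<open>\<sigma>\<close> of the reference point. The tilt equation is solved in balls of the larger radius \<open>\<delta>\<close> about these
  tilts, hence the \<open>2 * \<delta>\<close>. It requires \<open>r\<close> times the distance of two points of the \<open>\<sigma>\<close>-ball to be at most
  \<open>\<delta> / 2\<close>, so \<open>\<delta>\<close> has to be fixed before \<open>\<sigma>\<close>, and \<open>\<sigma>\<close> before \<open>\<delta>'\<close> and \<open>\<eta>\<close>.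
\<close>

lemma radii_exist:
  fixes K l r \<rho> :: real
  assumes "0 < K" "0 \<le> l" "0 < r" "0 < \<rho>"
  obtains \<delta> \<sigma> \<delta>' \<eta> where "0 < \<delta>" "0 < \<sigma>" "0 < \<delta>'" "0 < \<eta>"
    "2 * \<delta> \<le> \<rho>" "\<sigma> \<le> \<rho>" "\<delta>' \<le> \<delta>" "\<eta> \<le> \<rho>"
    "K * (2 * \<delta>) + l * sqrt \<eta> \<le> \<rho>" "K * \<delta>' + l * sqrt \<eta> \<le> \<sigma>" "r * (2 * \<sigma>) \<le> \<delta> / 2"
proof -
  define \<delta> where "\<delta> = min (\<rho> / 2) (\<rho> / (4 * K))"
  define \<sigma> where "\<sigma> = min (\<rho> / 2) (\<delta> / (4 * r))"
  define \<delta>' where "\<delta>' = min \<delta> (\<sigma> / (2 * K))"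
  define \<eta> where "\<eta> = min \<rho> ((\<sigma> / (2 * (l + 1)))\<^sup>2)"
  have d: "0 < \<delta>" "2 * \<delta> \<le> \<rho>" "K * (2 * \<delta>) \<le> \<rho> / 2"
    using assms unfolding \<delta>_def by (auto simp: field_simps min_def)
  have s: "0 < \<sigma>" "\<sigma> \<le> \<rho> / 2" "r * (2 * \<sigma>) \<le> \<delta> / 2"
    using assms d unfolding \<sigma>_def by (auto simp: field_simps min_def)
  have d': "0 < \<delta>'" "\<delta>' \<le> \<delta>" "K * \<delta>' \<le> \<sigma> / 2"
    using assms d s unfolding \<delta>'_def by (auto simp: field_simps min_def)
  have e: "0 < \<eta>" "\<eta> \<le> \<rho>" using assms s unfolding \<eta>_def by auto
  have "sqrt \<eta> \<le> sqrt ((\<sigma> / (2 * (l + 1)))\<^sup>2)" unfolding \<eta>_def by (intro real_sqrt_le_mono) simp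
  also have "\<dots> = \<sigma> / (2 * (l + 1))" using s assms by simp
  finally have "l * sqrt \<eta> \<le> l * (\<sigma> / (2 * (l + 1)))" using assms by (intro mult_left_mono)
  also have "\<dots> \<le> \<sigma> / 2" using s assms by (simp add: field_simps)
  finally have "l * sqrt \<eta> \<le> \<sigma> / 2" .
  then show thesis using that[of \<delta> \<sigma> \<delta>' \<eta>] d s d' e assms by linarith
qed

text \<open>
  Minimizers in the interior of the ball are solutions; conversely, \<open>support_point_unique\<close> leaves no
  other solution near \<open>xbar\<close>.
\<close>

lemma solution_if_minimizer:
  fixes g :: "'x::{real_inner, complete_space} \<Rightarrow> 'p::metric_space \<Rightarrow> ereal"
    and xbar vbar :: 'x and pbar :: 'p
  assumes ninf: "\<And>x p. g x p \<noteq> -\<infinity>"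
    and vbar: "vbar \<in> partial_subdiff g xbar pbar"
    and prox: "param_cont_prox_regular g xbar pbar vbar"
    and lipl: "lipschitz_like (\<lambda>p. epi (\<lambda>x. g x p)) pbar (xbar, \<alpha>)"
    and minz: "hoelder_fully_stable_minimizer g xbar vbar pbar"
  shows "hoelder_fully_stable_solution g xbar vbar pbar"
proof -
  obtain \<kappa> l \<gamma> V Q m
    where hoel': "\<forall>v1\<in>V. \<forall>v2\<in>V. \<forall>p1\<in>Q. \<forall>p2\<in>Q.
       norm (m v1 p1 - m v2 p2) \<le> \<kappa> * norm (v1 - v2) + l * sqrt (dist p1 p2)"
    and argm': "\<forall>v\<in>V. \<forall>p\<in>Q. argmin_map g xbar \<gamma> v p = {m v p}"
    and mbar: "m vbar pbar = xbar"
    and int: "vbar \<in> interior V" "pbar \<in> interior Q"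
    and "0 < \<kappa>" "0 < l" "0 < \<gamma>"
    using minz unfolding hoelder_fully_stable_minimizer_def
    by (elim exE conjE) (rule that, assumption+)
  note hoel = hoel'[rule_format] and argm = argm'[rule_format]
  obtain \<rho>0 r where "0 < \<rho>0" "0 < r"
    and supp0: "\<And>u p v. u \<in> cball xbar \<rho>0 \<Longrightarrow> p \<in> cball pbar \<rho>0 \<Longrightarrow> v \<in> cball vbar \<rho>0 \<Longrightarrow>
       v \<in> partial_subdiff g u p \<Longrightarrow> supports_on (cball xbar \<rho>0) r (\<lambda>x. g x p) u v"
    using prox_regular_supports_on[OF prox vbar] by blast
  obtain \<eta>0 where "0 < \<eta>0"
    and fin: "\<And>p. p \<in> cball pbar \<eta>0 \<Longrightarrow> \<exists>x\<in>cball xbar \<gamma>. g x p \<noteq> \<infinity>"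
    using lipschitz_like_epi_finite_nearby[OF lipl \<open>0 < \<gamma>\<close>] by blast
  obtain e1 where e1: "0 < e1" "cball vbar e1 \<subseteq> V" using int by (auto simp: mem_interior_cball)
  obtain e2 where e2: "0 < e2" "cball pbar e2 \<subseteq> Q" using int by (auto simp: mem_interior_cball)
  \<comment> \<open>The entry \<open>\<gamma> / 2\<close> keeps the minimizers in the interior of the \<open>\<gamma>\<close>-ball, where they are stationary.\<close>
  define \<rho> where "\<rho> = Min {\<rho>0, \<eta>0, e1, e2, \<gamma> / 2}"
  have rho: "0 < \<rho>" "\<rho> \<le> \<rho>0" "\<rho> \<le> \<eta>0" "\<rho> \<le> e1" "\<rho> \<le> e2" "\<rho> \<le> \<gamma> / 2"
    unfolding \<rho>_def using \<open>0 < \<rho>0\<close> \<open>0 < \<eta>0\<close> e1 e2 \<open>0 < \<gamma>\<close> by auto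
  obtain \<delta> \<sigma> \<delta>' \<eta> where rad: "0 < \<delta>" "0 < \<sigma>" "0 < \<delta>'" "0 < \<eta>"
    "2 * \<delta> \<le> \<rho>" "\<sigma> \<le> \<rho>" "\<delta>' \<le> \<delta>" "\<eta> \<le> \<rho>"
    "\<kappa> * (2 * \<delta>) + l * sqrt \<eta> \<le> \<rho>" "\<kappa> * \<delta>' + l * sqrt \<eta> \<le> \<sigma>" "r * (2 * \<sigma>) \<le> \<delta> / 2"
    using radii_exist[of \<kappa> l r \<rho>] \<open>0 < \<kappa>\<close> \<open>0 < l\<close> \<open>0 < r\<close> rho by (metis less_imp_le)
  have VQ: "v \<in> V" if "v \<in> cball vbar (2 * \<delta>)" for v
    using that rad rho e1(2) by auto
  have QQ: "p \<in> Q" if "p \<in> cball pbar \<eta>" for p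
    using that rad rho e2(2) by auto
  have bars: "vbar \<in> V" "pbar \<in> Q" using VQ[of vbar] QQ[of pbar] rad by auto
  have close: "norm (m v p - xbar) \<le> \<kappa> * t + l * sqrt \<eta>"
    if "v \<in> cball vbar (2 * \<delta>)" "p \<in> cball pbar \<eta>" "dist vbar v \<le> t" for v p t
  proof -
    have "norm (m v p - m vbar pbar) \<le> \<kappa> * norm (v - vbar) + l * sqrt (dist p pbar)"
      by (rule hoel) (use VQ QQ bars that in auto)
    also have "\<dots> \<le> \<kappa> * t + l * sqrt \<eta>"
      using that \<open>0 < \<kappa>\<close> \<open>0 < l\<close>
      by (intro add_mono mult_left_mono real_sqrt_le_mono) (auto simp: dist_norm norm_minus_commute dist_commute)
    finally show ?thesis using mbar by simp
  qed
  have m_rho: "m v p \<in> cball xbar \<rho>" if "v \<in> cball vbar (2 * \<delta>)" "p \<in> cball pbar \<eta>" for v p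
    using close[OF that, of "2 * \<delta>"] that rad by (auto simp: dist_norm norm_minus_commute)
  have m_sigma: "m v p \<in> cball xbar \<sigma>" if "v \<in> cball vbar \<delta>'" "p \<in> cball pbar \<eta>" for v p
    using close[of v p "\<delta>'"] that rad by (auto simp: dist_norm norm_minus_commute)
  have m_supp: "supports_on (cball xbar \<gamma>) 0 (\<lambda>x. g x p) (m v p) v"
    if "v \<in> cball vbar (2 * \<delta>)" "p \<in> cball pbar \<eta>" for v p
  proof -
    have "p \<in> cball pbar \<eta>0" using that rad rho by auto
    then obtain z where "z \<in> cball xbar \<gamma>" "g z p \<noteq> \<infinity>" using fin by blast
    then show ?thesis
      using argm[OF VQ[OF that(1)] QQ[OF that(2)]] is_arg_min_iff_supports_on[of "\<lambda>x. g x p" z "cball xbar \<gamma>" v]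
        ninf unfolding argmin_map_def by blast
  qed
  have m_mono: "0 \<le> (v - w) \<bullet> (m v p - m w p)"
    if "v \<in> cball vbar (2 * \<delta>)" "w \<in> cball vbar (2 * \<delta>)" "p \<in> cball pbar \<eta>" for v w p
    using supports_on_monotone[OF m_supp[OF that(1,3)] m_supp[OF that(2,3)]]
      m_rho[OF that(1,3)] m_rho[OF that(2,3)] rho by auto
  have m_lip: "norm (m v p - m w p) \<le> \<kappa> * norm (v - w)"
    if "v \<in> cball vbar (2 * \<delta>)" "w \<in> cball vbar (2 * \<delta>)" "p \<in> cball pbar \<eta>" for v w p
    using hoel[OF VQ[OF that(1)] VQ[OF that(2)] QQ[OF that(3)] QQ[OF that(3)]] by simp
  have ball2: "w \<in> cball vbar (2 * \<delta>)" if "v \<in> cball vbar \<delta>'" "w \<in> cball v \<delta>" for v w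
    using that dist_triangle[of vbar w v] rad by simp
  have sub2: "v \<in> cball vbar (2 * \<delta>)" if "v \<in> cball vbar \<delta>'" for v
    using ball2[OF that, of v] rad by simp
  have m_sol: "v \<in> partial_subdiff g (m v p) p" if "v \<in> cball vbar \<delta>'" "p \<in> cball pbar \<eta>" for v p
  proof (rule partial_subdiff_if_supports_on[of _ g, OF m_supp[OF sub2[OF that(1)] that(2)]])
    have "m v p \<in> ball xbar \<gamma>" using m_sigma[OF that] rad rho \<open>0 < \<gamma>\<close> by simp
    then show "m v p \<in> interior (cball xbar \<gamma>)" using ball_subset_cball interior_maximal open_ball by blast
  qed
  have only: "x = m v p"
    if v: "v \<in> cball vbar \<delta>'" and p: "p \<in> cball pbar \<eta>" and x: "x \<in> cball xbar \<sigma>"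
      and sol: "v \<in> partial_subdiff g x p" for v p x
  proof -
    have sx: "supports_on (cball xbar \<rho>0) r (\<lambda>x. g x p) x v"
      by (rule supp0[OF _ _ _ sol]) (use v p x rad rho in auto)
    have "norm (x - m v p) \<le> 2 * \<sigma>"
      using x m_sigma[OF v p] dist_triangle[of x "m v p" xbar] by (simp add: dist_norm norm_minus_commute)
    then have "r * norm (x - m v p) \<le> r * (2 * \<sigma>)" using \<open>0 < r\<close> by simp
    then have "r * norm (x - m v p) \<le> \<delta> / 2" using rad by linarith
    moreover have "norm (m w p - m w' p) \<le> \<kappa> * norm (w - w')" "0 \<le> (w - w') \<bullet> (m w p - m w' p)"
      if "w \<in> cball v \<delta>" "w' \<in> cball v \<delta>" for w w'
      using m_lip[OF ball2[OF v that(1)] ball2[OF v that(2)] p]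
        m_mono[OF ball2[OF v that(1)] ball2[OF v that(2)] p] by simp_all
    moreover have "supports_on (cball xbar \<gamma>) 0 (\<lambda>x. g x p) (m w p) w" "m w p \<in> cball xbar \<rho>0"
      if "w \<in> cball v \<delta>" for w
      using m_supp[OF ball2[OF v that] p] m_rho[OF ball2[OF v that] p] rho by simp_all
    moreover have "x \<in> cball xbar \<gamma>" using x rad rho \<open>0 < \<gamma>\<close> by simp
    ultimately show ?thesis
      using support_point_unique[OF rad(1) less_imp_le[OF \<open>0 < \<kappa>\<close>] \<open>0 < r\<close>, of 0 r v "\<lambda>w. m w p" x
          "cball xbar \<gamma>" "\<lambda>x. g x p" "cball xbar \<rho>0"] sx by simp
  qed
  \<comment> \<open>The modulus of strong monotonicity: twice the growth constant \<open>1 / (4 \<kappa>)\<close>, one for each base point.\<close>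
  define c where "c = 1 / (2 * \<kappa>)"
  have c: "0 < c" unfolding c_def using \<open>0 < \<kappa>\<close> by simp
  have strong: "c * (norm (m v p - m w p))\<^sup>2 \<le> (v - w) \<bullet> (m v p - m w p)"
    if v: "v \<in> cball vbar \<delta>'" and w: "w \<in> cball vbar \<delta>'" and p: "p \<in> cball pbar \<eta>" for v w p
  proof -
    define U' where "U' = {m v p, m w p}"
    have "norm (v - w) \<le> 2 * \<delta>"
      using v w rad dist_triangle[of v w vbar] by (simp add: dist_norm norm_minus_commute)
    then have "\<kappa> * norm (v - w) \<le> \<kappa> * (2 * \<delta>)" using \<open>0 < \<kappa>\<close> by (intro mult_left_mono) auto
    then have vw: "norm (m v p - m w p) \<le> 2 * \<kappa> * \<delta>" "norm (m w p - m v p) \<le> 2 * \<kappa> * \<delta>"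
      using m_lip[OF sub2[OF v] sub2[OF w] p] by (simp_all add: norm_minus_commute mult_ac)
    have "0 \<le> 2 * \<kappa> * \<delta>" using \<open>0 < \<kappa>\<close> rad by simp
    with vw have U'd: "norm (x - m v p) \<le> 2 * \<kappa> * \<delta>" "norm (x - m w p) \<le> 2 * \<kappa> * \<delta>"
      if "x \<in> U'" for x
      using that unfolding U'_def by auto
    have grow: "supports_on U' (- (1 / (2 * \<kappa>))) (\<lambda>x. g x p) (m a p) a"
      if a: "a \<in> cball vbar \<delta>'" and near: "\<And>x. x \<in> U' \<Longrightarrow> norm (x - m a p) \<le> 2 * \<kappa> * \<delta>" for a
    proof (rule quadratic_growth_of_lipschitz_minimizers[OF \<open>0 < \<kappa>\<close>, where \<delta> = \<delta> and T = "\<lambda>w. m w p"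
          and U = "cball xbar \<gamma>"])
      show "norm (m b p - m a p) \<le> \<kappa> * norm (b - a)" if "b \<in> cball a \<delta>" for b
        by (rule m_lip[OF ball2[OF a that] sub2[OF a] p])
      show "supports_on (cball xbar \<gamma>) 0 (\<lambda>x. g x p) (m b p) b" if "b \<in> cball a \<delta>" for b
        by (rule m_supp[OF ball2[OF a that] p])
      show "m b p \<in> cball xbar \<gamma>" if "b \<in> cball a \<delta>" for b
        using m_rho[OF ball2[OF a that] p] rho \<open>0 < \<gamma>\<close> by simp
      show "U' \<subseteq> cball xbar \<gamma>"
        using m_rho[OF sub2[OF v] p] m_rho[OF sub2[OF w] p] rho \<open>0 < \<gamma>\<close> unfolding U'_def by simp
      show "0 \<le> \<delta>" using rad by simp
      show "norm (x - m a p) \<le> 2 * \<kappa> * \<delta>" if "x \<in> U'" for x by (rule near[OF that])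
    qed
    have mem: "m v p \<in> U'" "m w p \<in> U'" unfolding U'_def by simp_all
    show ?thesis
      using supports_on_monotone[OF grow[OF v U'd(1)] grow[OF w U'd(2)] mem(2,1)]
      unfolding c_def by simp
  qed
  \<comment> \<open>For a common parameter the square of the left side is
    \<open>\<parallel>a\<parallel>\<^sup>2 - 4c (\<langle>a, b\<rangle> - c \<parallel>b\<parallel>\<^sup>2) \<le> \<parallel>a\<parallel>\<^sup>2\<close>; the change of parameter costs the Hoelder term.\<close>
  have est: "norm ((v1 - v2) - (2 * c) *\<^sub>R (m v1 p1 - m v2 p2))
      \<le> norm (v1 - v2) + 2 * c * l * sqrt (dist p1 p2)"
    if v: "v1 \<in> cball vbar \<delta>'" "v2 \<in> cball vbar \<delta>'" and p: "p1 \<in> cball pbar \<eta>" "p2 \<in> cball pbar \<eta>"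
    for v1 v2 p1 p2
  proof -
    define a where "a = v1 - v2"
    define b where "b = m v1 p1 - m v2 p1"
    define d where "d = m v2 p1 - m v2 p2"
    have "c * (norm b)\<^sup>2 \<le> a \<bullet> b" unfolding a_def b_def by (rule strong[OF v p(1)])
    then have "4 * c * (c * (norm b)\<^sup>2) \<le> 4 * c * (a \<bullet> b)" using c by (intro mult_left_mono) auto
    moreover have "(norm (a - (2 * c) *\<^sub>R b))\<^sup>2 = (norm a)\<^sup>2 - 4 * c * (a \<bullet> b) + 4 * c * (c * (norm b)\<^sup>2)"
      unfolding power2_norm_eq_inner
      by (simp add: inner_diff_left inner_diff_right inner_commute algebra_simps)
    ultimately have "(norm (a - (2 * c) *\<^sub>R b))\<^sup>2 \<le> (norm a)\<^sup>2" by linarith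
    then have 1: "norm (a - (2 * c) *\<^sub>R b) \<le> norm a" by (rule power2_le_imp_le) simp
    have "norm d \<le> l * sqrt (dist p1 p2)"
      using hoel[OF VQ[OF sub2[OF v(2)]] VQ[OF sub2[OF v(2)]] QQ[OF p(1)] QQ[OF p(2)]]
      unfolding d_def by simp
    then have 2: "norm ((2 * c) *\<^sub>R d) \<le> 2 * c * l * sqrt (dist p1 p2)"
      using c mult_left_mono[of "norm d" _ "2 * c"] by simp
    have eq: "(v1 - v2) - (2 * c) *\<^sub>R (m v1 p1 - m v2 p2) = (a - (2 * c) *\<^sub>R b) - (2 * c) *\<^sub>R d"
      unfolding a_def b_def d_def by (simp add: algebra_simps)
    show ?thesis
      unfolding eq unfolding a_def[symmetric]
      using 1 2 norm_triangle_ineq4[of "a - (2 * c) *\<^sub>R b" "(2 * c) *\<^sub>R d"] by linarith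
  qed
  have int': "vbar \<in> interior (cball vbar \<delta>')" "pbar \<in> interior (cball pbar \<eta>)"
      "xbar \<in> interior (cball xbar \<sigma>)"
    using rad by (auto simp: mem_interior_cball)
  have graph: "{(v, p, m v p) | v p. v \<in> cball vbar \<delta>' \<and> p \<in> cball pbar \<eta>}
      = {(v, p, x). x \<in> solution_map g v p} \<inter> (cball vbar \<delta>' \<times> cball pbar \<eta> \<times> cball xbar \<sigma>)"
    (is "?L = ?R")
  proof
    show "?L \<subseteq> ?R"
    proof
      fix z assume "z \<in> ?L"
      then obtain v p where "z = (v, p, m v p)" "v \<in> cball vbar \<delta>'" "p \<in> cball pbar \<eta>" by blast
      then show "z \<in> ?R" using m_sol[of v p] m_sigma[of v p] unfolding solution_map_def by simp
    qed
    show "?R \<subseteq> ?L"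
    proof
      fix z assume "z \<in> ?R"
      then obtain v p x where z: "z = (v, p, x)" "v \<in> cball vbar \<delta>'" "p \<in> cball pbar \<eta>"
        "x \<in> cball xbar \<sigma>" "v \<in> partial_subdiff g x p"
        unfolding solution_map_def by auto
      then have "x = m v p" using only by blast
      with z show "z \<in> ?L" by blast
    qed
  qed
  have xsol: "xbar \<in> solution_map g vbar pbar" using vbar unfolding solution_map_def by simp
  have cl: "0 < 2 * c * l" using c \<open>0 < l\<close> by simp
  have range: "\<forall>v\<in>cball vbar \<delta>'. \<forall>p\<in>cball pbar \<eta>. m v p \<in> cball xbar \<sigma>" using m_sigma by blast
  have est': "\<forall>v1\<in>cball vbar \<delta>'. \<forall>v2\<in>cball vbar \<delta>'. \<forall>p1\<in>cball pbar \<eta>. \<forall>p2\<in>cball pbar \<eta>.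
      norm ((v1 - v2) - (2 * c) *\<^sub>R (m v1 p1 - m v2 p2))
        \<le> norm (v1 - v2) + 2 * c * l * sqrt (dist p1 p2)"
    using est by blast
  show ?thesis
    unfolding hoelder_fully_stable_solution_def
    by (rule conjI[OF xsol], rule exI[of _ "cball vbar \<delta>'"], rule exI[of _ "cball pbar \<eta>"],
        rule exI[of _ "cball xbar \<sigma>"], rule exI[of _ c], rule conjI[OF c], rule exI[of _ "2 * c * l"],
        rule conjI[OF cl], rule exI[of _ m],
        rule conjI[OF int'(1) conjI[OF int'(2) conjI[OF int'(3) conjI[OF range conjI[OF graph est']]]]])
qed

text \<open>
  The radius \<open>\<sigma>\<close> of the ball of admissible \<open>x\<close> is chosen so small, compared with the radius \<open>\<delta>\<close> available
  for tilts, that the tilt equation is solvable for every point of that ball.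
\<close>

lemma minimizer_if_solution:
  fixes g :: "'x::{real_inner, complete_space} \<Rightarrow> 'p::metric_space \<Rightarrow> ereal"
    and xbar vbar :: 'x and pbar :: 'p
  assumes ninf: "\<And>x p. g x p \<noteq> -\<infinity>"
    and prox: "param_cont_prox_regular g xbar pbar vbar"
    and sol: "hoelder_fully_stable_solution g xbar vbar pbar"
  shows "hoelder_fully_stable_minimizer g xbar vbar pbar"
proof -
  have vbar: "vbar \<in> partial_subdiff g xbar pbar"
    using sol unfolding hoelder_fully_stable_solution_def solution_map_def by simp
  obtain V Q U \<kappa> l \<theta> where "0 < \<kappa>" "0 < l"
    and int: "vbar \<in> interior V" "pbar \<in> interior Q" "xbar \<in> interior U"
    and graph: "{(v, p, \<theta> v p) | v p. v \<in> V \<and> p \<in> Q}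
          = {(v, p, x). x \<in> solution_map g v p} \<inter> (V \<times> Q \<times> U)"
    and hoel: "\<And>v1 v2 p1 p2. v1 \<in> V \<Longrightarrow> v2 \<in> V \<Longrightarrow> p1 \<in> Q \<Longrightarrow> p2 \<in> Q \<Longrightarrow>
       norm ((v1 - v2) - (2 * \<kappa>) *\<^sub>R (\<theta> v1 p1 - \<theta> v2 p2)) \<le> norm (v1 - v2) + l * sqrt (dist p1 p2)"
    using sol unfolding hoelder_fully_stable_solution_def by meson
  have bars: "vbar \<in> V" "pbar \<in> Q" "xbar \<in> U" using int interior_subset by blast+
  have th_sol: "v \<in> partial_subdiff g (\<theta> v p) p" if "v \<in> V" "p \<in> Q" for v p
    using that graph unfolding solution_map_def by blast
  have th_bar: "\<theta> vbar pbar = xbar"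
  proof -
    have "(vbar, pbar, xbar) \<in> {(v, p, \<theta> v p) | v p. v \<in> V \<and> p \<in> Q}"
      unfolding graph using bars vbar by (simp add: solution_map_def)
    then show ?thesis by simp
  qed
  define K where "K = 1 / \<kappa>"
  define L where "L = l / (2 * \<kappa>)"
  have KL: "0 < K" "0 < L" using \<open>0 < \<kappa>\<close> \<open>0 < l\<close> unfolding K_def L_def by auto
  \<comment> \<open>The single estimate on \<open>\<theta>\<close> encodes both the Hoelder bound, by the triangle inequality, and, for a common
    parameter, monotonicity, by squaring it.\<close>
  have th_hoel: "norm (\<theta> v1 p1 - \<theta> v2 p2) \<le> K * norm (v1 - v2) + L * sqrt (dist p1 p2)"
    if "v1 \<in> V" "v2 \<in> V" "p1 \<in> Q" "p2 \<in> Q" for v1 v2 p1 p2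
  proof -
    define a where "a = v1 - v2"
    define b where "b = (2 * \<kappa>) *\<^sub>R (\<theta> v1 p1 - \<theta> v2 p2)"
    have "norm b \<le> norm (a - b) + norm a"
      using norm_triangle_ineq4[of a "a - b"] by simp
    then have "2 * \<kappa> * norm (\<theta> v1 p1 - \<theta> v2 p2) \<le> 2 * norm (v1 - v2) + l * sqrt (dist p1 p2)"
      using hoel[OF that] \<open>0 < \<kappa>\<close> unfolding a_def b_def by simp
    then show ?thesis unfolding K_def L_def using \<open>0 < \<kappa>\<close> by (simp add: field_simps)
  qed
  have th_mono: "0 \<le> (v - w) \<bullet> (\<theta> v p - \<theta> w p)" if "v \<in> V" "w \<in> V" "p \<in> Q" for v w p
  proof -
    define a where "a = v - w"
    define b where "b = (2 * \<kappa>) *\<^sub>R (\<theta> v p - \<theta> w p)"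
    have "norm (a - b) \<le> norm a" using hoel[OF that(1,2,3,3)] unfolding a_def b_def by simp
    then have "(norm (a - b))\<^sup>2 \<le> (norm a)\<^sup>2" by (intro power_mono) auto
    then have "(norm b)\<^sup>2 \<le> 2 * (a \<bullet> b)"
      unfolding power2_norm_eq_inner by (simp add: inner_diff_left inner_diff_right inner_commute)
    then have "0 \<le> a \<bullet> b" using zero_le_power2[of "norm b"] by linarith
    then show ?thesis unfolding a_def b_def using \<open>0 < \<kappa>\<close> by (simp add: zero_le_mult_iff)
  qed
  obtain \<rho>0 r where "0 < \<rho>0" "0 < r"
    and supp0: "\<And>u p v. u \<in> cball xbar \<rho>0 \<Longrightarrow> p \<in> cball pbar \<rho>0 \<Longrightarrow> v \<in> cball vbar \<rho>0 \<Longrightarrow>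
       v \<in> partial_subdiff g u p \<Longrightarrow> supports_on (cball xbar \<rho>0) r (\<lambda>x. g x p) u v"
    using prox_regular_supports_on[OF prox vbar] by blast
  obtain e1 where e1: "0 < e1" "cball vbar e1 \<subseteq> V" using int by (auto simp: mem_interior_cball)
  obtain e2 where e2: "0 < e2" "cball pbar e2 \<subseteq> Q" using int by (auto simp: mem_interior_cball)
  define \<rho> where "\<rho> = Min {\<rho>0, e1, e2}"
  have rho: "0 < \<rho>" "\<rho> \<le> \<rho>0" "\<rho> \<le> e1" "\<rho> \<le> e2"
    unfolding \<rho>_def using \<open>0 < \<rho>0\<close> e1 e2 by auto
  obtain \<delta> \<sigma> \<delta>' \<eta> where rad: "0 < \<delta>" "0 < \<sigma>" "0 < \<delta>'" "0 < \<eta>"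
    "2 * \<delta> \<le> \<rho>" "\<sigma> \<le> \<rho>" "\<delta>' \<le> \<delta>" "\<eta> \<le> \<rho>"
    "K * (2 * \<delta>) + L * sqrt \<eta> \<le> \<rho>" "K * \<delta>' + L * sqrt \<eta> \<le> \<sigma>" "r * (2 * \<sigma>) \<le> \<delta> / 2"
    using radii_exist[of K L r \<rho>] KL \<open>0 < r\<close> rho by (metis less_imp_le)
  have VQ: "v \<in> V" if "v \<in> cball vbar (2 * \<delta>)" for v
    using that rad rho e1(2) by auto
  have QQ: "p \<in> Q" if "p \<in> cball pbar \<eta>" for p
    using that rad rho e2(2) by auto
  have close: "norm (\<theta> v p - xbar) \<le> K * t + L * sqrt \<eta>"
    if "v \<in> cball vbar (2 * \<delta>)" "p \<in> cball pbar \<eta>" "dist vbar v \<le> t" for v p t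
  proof -
    have "norm (\<theta> v p - \<theta> vbar pbar) \<le> K * norm (v - vbar) + L * sqrt (dist p pbar)"
      by (rule th_hoel) (use VQ QQ bars that in auto)
    also have "\<dots> \<le> K * t + L * sqrt \<eta>"
      using that KL
      by (intro add_mono mult_left_mono real_sqrt_le_mono) (auto simp: dist_norm norm_minus_commute dist_commute)
    finally show ?thesis using th_bar by simp
  qed
  have th_rho: "\<theta> v p \<in> cball xbar \<rho>" if "v \<in> cball vbar (2 * \<delta>)" "p \<in> cball pbar \<eta>" for v p
    using close[OF that, of "2 * \<delta>"] that rad by (auto simp: dist_norm norm_minus_commute)
  have th_sigma: "\<theta> v p \<in> cball xbar \<sigma>" if "v \<in> cball vbar \<delta>'" "p \<in> cball pbar \<eta>" for v p
    using close[of v p "\<delta>'"] that rad by (auto simp: dist_norm norm_minus_commute)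
  have ball2: "w \<in> cball vbar (2 * \<delta>)" if "v \<in> cball vbar \<delta>'" "w \<in> cball v \<delta>" for v w
    using that dist_triangle[of vbar w v] rad by simp
  have sub2: "v \<in> cball vbar (2 * \<delta>)" if "v \<in> cball vbar \<delta>'" for v
    using ball2[OF that, of v] rad by simp
  have argm: "argmin_map g xbar \<sigma> v p = {\<theta> v p}" if v: "v \<in> cball vbar \<delta>'" and p: "p \<in> cball pbar \<eta>" for v p
  proof -
    have lip: "norm (\<theta> w p - \<theta> w' p) \<le> K * norm (w - w')" if "w \<in> cball v \<delta>" "w' \<in> cball v \<delta>" for w w'
      using th_hoel[OF VQ[OF ball2[OF v that(1)]] VQ[OF ball2[OF v that(2)]] QQ[OF p] QQ[OF p]] by simp
    have mono: "0 \<le> (w - w') \<bullet> (\<theta> w p - \<theta> w' p)" if "w \<in> cball v \<delta>" "w' \<in> cball v \<delta>" for w w'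
      using th_mono[OF VQ[OF ball2[OF v that(1)]] VQ[OF ball2[OF v that(2)]] QQ[OF p]] .
    have supp: "supports_on (cball xbar \<rho>) r (\<lambda>x. g x p) (\<theta> w p) w" if w: "w \<in> cball v \<delta>" for w
    proof -
      note w2 = ball2[OF v w]
      have "supports_on (cball xbar \<rho>0) r (\<lambda>x. g x p) (\<theta> w p) w"
        by (rule supp0[OF _ _ _ th_sol[OF VQ[OF w2] QQ[OF p]]]) (use th_rho[OF w2 p] w2 p rad rho in auto)
      then show ?thesis by (rule supports_on_subset) (use rho in auto)
    qed
    have near: "r * norm (x - \<theta> v p) \<le> \<delta> / 2" if x: "x \<in> cball xbar \<sigma>" for x
    proof -
      have "norm (x - \<theta> v p) \<le> 2 * \<sigma>"
        using x th_sigma[OF v p] dist_triangle[of x "\<theta> v p" xbar] by (simp add: dist_norm norm_minus_commute)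
      then have "r * norm (x - \<theta> v p) \<le> r * (2 * \<sigma>)" using \<open>0 < r\<close> by simp
      then show ?thesis using rad by linarith
    qed
    have inrho: "\<theta> w p \<in> cball xbar \<rho>" if "w \<in> cball v \<delta>" for w
      using th_rho[OF ball2[OF v that] p] .
    have below: "supports_on (cball xbar \<sigma> \<union> (\<lambda>w. \<theta> w p) ` cball v \<delta>) 0 (\<lambda>x. g x p) (\<theta> v p) v"
      by (rule prox_subgradients_become_subgradients[OF rad(1) less_imp_le[OF KL(1)] \<open>0 < r\<close> lip mono supp inrho _ near])
        (use rad in auto)
    then have min: "supports_on (cball xbar \<sigma>) 0 (\<lambda>x. g x p) (\<theta> v p) v"
      by (rule supports_on_subset) simp
    then have fin: "g (\<theta> v p) p \<noteq> \<infinity>" unfolding supports_on_def by auto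
    note iff = is_arg_min_iff_supports_on[of "\<lambda>x. g x p", OF ninf th_sigma[OF v p] fin, of v]
    have "x = \<theta> v p" if x: "x \<in> cball xbar \<sigma>" "supports_on (cball xbar \<sigma>) 0 (\<lambda>x. g x p) x v" for x
    proof -
      have "x \<in> cball xbar \<rho>" using x rad by auto
      moreover have "supports_on (cball xbar \<sigma> \<union> (\<lambda>w. \<theta> w p) ` cball v \<delta>) 0 (\<lambda>x. g x p) x v"
        by (rule supports_on_transfer[OF below x(2) th_sigma[OF v p]])
      ultimately show ?thesis
        using support_point_unique[OF rad(1) less_imp_le[OF KL(1)] \<open>0 < r\<close> _ lip mono near[OF x(1)] supp,
            of 0 "cball xbar \<sigma> \<union> (\<lambda>w. \<theta> w p) ` cball v \<delta>"]
        by simp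
    qed
    then show ?thesis
      unfolding argmin_map_def iff using min th_sigma[OF v p] by blast
  qed
  have i: "vbar \<in> interior (cball vbar \<delta>')" "pbar \<in> interior (cball pbar \<eta>)"
    using rad by (auto simp: mem_interior_cball)
  have est: "\<forall>v1\<in>cball vbar \<delta>'. \<forall>v2\<in>cball vbar \<delta>'. \<forall>p1\<in>cball pbar \<eta>. \<forall>p2\<in>cball pbar \<eta>.
      norm (\<theta> v1 p1 - \<theta> v2 p2) \<le> K * norm (v1 - v2) + L * sqrt (dist p1 p2)"
    using th_hoel[OF VQ[OF sub2] VQ[OF sub2] QQ QQ] by simp
  have argm': "\<forall>v\<in>cball vbar \<delta>'. \<forall>p\<in>cball pbar \<eta>. argmin_map g xbar \<sigma> v p = {\<theta> v p}"
    using argm by blast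
  show ?thesis
    unfolding hoelder_fully_stable_minimizer_def
    by (rule exI[of _ K], rule conjI[OF KL(1)], rule exI[of _ L], rule conjI[OF KL(2)],
        rule exI[of _ \<sigma>], rule conjI[OF rad(2)], rule exI[of _ "cball vbar \<delta>'"],
        rule exI[of _ "cball pbar \<eta>"], rule exI[of _ \<theta>],
        rule conjI[OF i(1) conjI[OF i(2) conjI[OF argm' conjI[OF th_bar est]]]])
qed

theorem corollary4p5:
  fixes g :: "'x::{real_inner, complete_space} \<Rightarrow> 'p::metric_space \<Rightarrow> ereal"
    and xbar vbar :: 'x and pbar :: 'p
  assumes "\<And>x p. g x p \<noteq> -\<infinity>"
    and "lower_semicontinuous (\<lambda>(x, p). g x p)"
    and "vbar \<in> partial_subdiff g xbar pbar"
    and "param_cont_prox_regular g xbar pbar vbar"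
    and "lipschitz_like (\<lambda>p. epi (\<lambda>x. g x p)) pbar (xbar, real_of_ereal (g xbar pbar))"
  shows "hoelder_fully_stable_minimizer g xbar vbar pbar \<longleftrightarrow>
         hoelder_fully_stable_solution g xbar vbar pbar"
  by (rule iffI[OF solution_if_minimizer[OF assms(1,3,4,5)] minimizer_if_solution[OF assms(1,4)]])

end
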